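(* Let $f:\mathbb{Z}_+\to\mathbb{C}$ and $F(x)=1+\sum_{\ell=1}^\infty f(\ell)x^\ell$. Then for every $n\in\mathbb{Z}_{\geq0}$ and every odd $k\in\mathbb{Z}_+$, \[m_n:=\sum_{M\in\mathcal{M}_n^{(k)}}\prod_{i=1}^{|\mathbf{u}(M)|}f(\mathbf{u}(M)_i)=\sum_{i=0}^{\lfloor n/2\rfloor}\frac{1}{\frac{k+1}2n-i+1}\binom{\frac{k+1}2n-i+1}{n-2i}[x^i]F(x)^{\frac{k+1}2n-i+1},\] and the generating function $M(x)=\sum_{n\geq0}m_nx^n$ satisfies $M(x)=F(x^2M(x)^k)\big(1+xM(x)^{\frac{k+1}2}\big)$.
   Context: For odd $k\in\mathbb{Z}_+$, $\mathcal{M}_n^{(k)}$ (the $k$-Motzkin paths of size $n$) is the set of lattice paths from $(0,0)$ to $(\frac{k+1}2n,0)$ with step set $\{(1,k),(1,\frac{k-1}2),(1,-1)\}$ that never go below the $x$-axis. For $M\in\mathcal{M}_n^{(k)}$, $\mathbf{u}(M)$ is the vector recording, in order, the lengths of the maximal blocks of consecutive $(1,k)$ steps in $M$. Empty products equal $1$. *)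

theory Defs
  imports
    Complex_Main
    "HOL-Library.Product_Plus"
    "HOL-Computational_Algebra.Formal_Power_Series"
begin

definition motzkin_steps :: "nat \<Rightarrow> (int \<times> int) set" where
  "motzkin_steps k = {(1, int k), (1, int ((k - 1) div 2)), (1, - 1)}"

(* A lattice path starting at (0,0) is encoded by its list of steps; the lattice point reached
   after j steps is the componentwise sum of the first j steps. *)
definition motzkin_paths :: "nat \<Rightarrow> nat \<Rightarrow> (int \<times> int) list set" where
  "motzkin_paths k n =
     {M. set M \<subseteq> motzkin_steps k \<and>
         sum_list M = (int ((k + 1) div 2 * n), 0) \<and>
         (\<forall>j\<le>length M. 0 \<le> snd (sum_list (take j M)))}"

function block_lengths :: "'a \<Rightarrow> 'a list \<Rightarrow> nat list" where
  "block_lengths s [] = []"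
| "block_lengths s (x # xs) =
     (if x = s
      then length (takeWhile (\<lambda>y. y = s) (x # xs)) # block_lengths s (dropWhile (\<lambda>y. y = s) xs)
      else block_lengths s xs)"
  by pat_completeness auto
termination
  by (relation "measure (\<lambda>(s, xs). length xs)") (auto simp: le_imp_less_Suc length_dropWhile_le)

definition up_blocks :: "nat \<Rightarrow> (int \<times> int) list \<Rightarrow> nat list" where
  "up_blocks k M = block_lengths (1, int k) M"

definition motzkin_sum :: "(nat \<Rightarrow> complex) \<Rightarrow> nat \<Rightarrow> nat \<Rightarrow> complex" where
  "motzkin_sum f k n =
     (\<Sum>M\<in>motzkin_paths k n. \<Prod>i<length (up_blocks k M). f (up_blocks k M ! i))"

(* The weight f is a function on the positive integers, so its value at 0 is never used. *)
definition weight_fps :: "(nat \<Rightarrow> complex) \<Rightarrow> complex fps" where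
  "weight_fps f = Abs_fps (\<lambda>l. if l = 0 then 1 else f l)"

(* Every step advances the first coordinate by 1, so the endpoint determines the number of steps;
   hence the sum over all paths is a finite sum. *)
lemma finite_motzkin_paths: "finite (motzkin_paths k n)"
proof (rule finite_subset)
  have len: "fst (sum_list M) = int (length M)" if "set M \<subseteq> motzkin_steps k" for M
    using that by (induction M) (auto simp: motzkin_steps_def)
  show "motzkin_paths k n \<subseteq>
      {M. set M \<subseteq> motzkin_steps k \<and> length M = (k + 1) div 2 * n}"
  proof
    fix M assume M: "M \<in> motzkin_paths k n"
    then have "set M \<subseteq> motzkin_steps k" "fst (sum_list M) = int ((k + 1) div 2 * n)"
      by (simp_all add: motzkin_paths_def)
    then show "M \<in> {M. set M \<subseteq> motzkin_steps k \<and> length M = (k + 1) div 2 * n}"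
      using len[of M] by (metis (mono_tags, lifting) mem_Collect_eq of_nat_eq_iff)
  qed
  show "finite {M. set M \<subseteq> motzkin_steps k \<and> length M = (k + 1) div 2 * n}"
    by (rule finite_lists_length_eq) (simp add: motzkin_steps_def)
qed

end

theory Submission
  imports Defs
begin

unbundle fps_syntax

text \<open>
  Let \<open>h = (k + 1) / 2\<close>, \<open>c\<^sub>0 = 1\<close> and \<open>c\<^sub>l = f l\<close> for \<open>l > 0\<close>, and let \<open>G\<^sub>p\<close> be the weighted
  generating function of the paths from height \<open>p - 1\<close> to \<open>0\<close> (with \<open>G\<^sub>0 = 1\<close>). Splitting off the
  initial block of \<open>l \<ge> 0\<close> up steps together with the step after it gives the linear recursion
  \<open>G\<^sub>p\<^sub>+\<^sub>1 = (\<Sum>l. c\<^sub>l x\<^sup>2\<^sup>l (G\<^sub>p\<^sub>+\<^sub>k\<^sub>l + x G\<^sub>p\<^sub>+\<^sub>k\<^sub>l\<^sub>+\<^sub>h))\<close>, where a final down step to height \<open>-1\<close> is imagined at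
  the end of each path. Only \<open>G\<^sub>p\<close> itself enters without a power of \<open>x\<close> in front, so the recursion
  has a unique solution for given \<open>G\<^sub>0\<close>. Being linear, it is solved by \<open>p \<mapsto> G\<^sub>p G\<^sub>q\<close> as well as by
  \<open>p \<mapsto> G\<^sub>p\<^sub>+\<^sub>q\<close>; hence \<open>G\<^sub>p = G\<^sub>1\<^sup>p\<close>, and the case \<open>p = 0\<close> of the recursion is the functional equation.
  The coefficients \<open>p/N binom(N, n - 2i) [x\<^sup>i] F\<^sup>N\<close> with \<open>N = h n - i + p\<close> satisfy the same recursion,
  so Lagrange inversion is not needed.
\<close>

subsection \<open>The block recursion\<close>

text \<open>Stopping at \<open>n\<close> loses nothing: \<open>fps_X ^ (2 * l)\<close> kills every
  term with \<open>2 * l > n\<close>.\<close>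

definition block_recursion ::
    "(nat \<Rightarrow> 'a::comm_ring_1) \<Rightarrow> nat \<Rightarrow> nat \<Rightarrow> (nat \<Rightarrow> 'a fps) \<Rightarrow> bool" where
  "block_recursion c h k G \<longleftrightarrow>
     (\<forall>p n. G (Suc p) $ n =
        (\<Sum>l\<le>n. c l * (fps_X ^ (2 * l) * (G (p + k * l) + fps_X * G (p + k * l + h))) $ n))"

lemma block_recursion_unique:
  assumes G: "block_recursion c h k G" and H: "block_recursion c h k H" and "G 0 = H 0"
  shows "G p = H p"
proof -
  have "\<forall>p. G p $ n = H p $ n" for n
  proof (induction n rule: less_induct)
    case (less n)
    have "G p $ n = H p $ n" for p
    proof (induction p)
      case 0
      show ?case using assms(3) by simp
    next
      case (Suc p)
      \<comment> \<open>For \<open>l = 0\<close> the coefficient of \<open>G p\<close> at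
        \<open>n\<close> comes from the inner induction. All other coefficients have index below
        \<open>n\<close> and come from the outer one, for every \<open>p\<close>.\<close>
      have "(fps_X ^ (2 * l) * (G (p + k * l) + fps_X * G (p + k * l + h))) $ n =
            (fps_X ^ (2 * l) * (H (p + k * l) + fps_X * H (p + k * l + h))) $ n" for l
        using Suc less by (cases "l = 0") (auto simp: fps_X_power_mult_nth)
      then show ?case
        using G H by (simp add: block_recursion_def)
    qed
    then show ?case by blast
  qed
  then show ?thesis by (simp add: fps_eq_iff)
qed

lemma block_recursion_mult:
  assumes G: "block_recursion c h k G"
  shows "block_recursion c h k (\<lambda>p. G p * A)"
  unfolding block_recursion_def
proof (intro allI)
  fix p n
  define T where "T l = fps_X ^ (2 * l) * (G (p + k * l) + fps_X * G (p + k * l + h))" for l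
  \<comment> \<open>A bound independent of \<open>j\<close> lets the Cauchy product and the sum over
    \<open>l\<close> be interchanged; the added terms have \<open>l > j\<close> and vanish.\<close>
  have "G (Suc p) $ j = (\<Sum>l\<le>n. c l * T l $ j)" if "j \<le> n" for j
  proof -
    have "G (Suc p) $ j = (\<Sum>l\<le>j. c l * T l $ j)"
      using G by (simp add: block_recursion_def T_def)
    also have "\<dots> = (\<Sum>l\<le>n. c l * T l $ j)"
      using that by (intro sum.mono_neutral_left) (auto simp: T_def fps_X_power_mult_nth)
    finally show ?thesis .
  qed
  then have "(G (Suc p) * A) $ n = (\<Sum>j=0..n. \<Sum>l\<le>n. c l * (T l $ j * A $ (n - j)))"
    by (simp add: fps_mult_nth sum_distrib_right mult.assoc)
  also have "\<dots> = (\<Sum>l\<le>n. c l * (T l * A) $ n)"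
    by (subst sum.swap) (simp add: fps_mult_nth sum_distrib_left)
  finally show "(G (Suc p) * A) $ n =
      (\<Sum>l\<le>n. c l * (fps_X ^ (2 * l) * (G (p + k * l) * A + fps_X * (G (p + k * l + h) * A))) $ n)"
    by (simp add: T_def algebra_simps)
qed

text \<open>Algebraic form of the first-passage decomposition: a descent through \<open>p\<close>
  levels is \<open>p\<close> independent descents through one level. \<open>G (Suc q)\<close> and
  \<open>G q * G 1\<close> solve the same recursion and agree at \<open>q = 0\<close>.\<close>

lemma block_recursion_power:
  assumes G: "block_recursion c h k G" and "G 0 = 1"
  shows "G p = G 1 ^ p"
proof (induction p)
  case (Suc p)
  have "block_recursion c h k (\<lambda>q. G (Suc q))"
    using G by (simp add: block_recursion_def flip: add_Suc)
  then have "G (Suc p) = G p * G 1"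
    using block_recursion_unique[OF _ block_recursion_mult[OF G, of "G 1"]] assms(2)
    by (simp add: One_nat_def)
  then show ?case using Suc by (simp add: mult.commute)
qed (use assms in simp)

lemma fps_compose_mult_nth:
  fixes F B T :: "'a::comm_ring_1 fps"
  assumes "B $ 0 = 0"
  shows "((F oo B) * T) $ n = (\<Sum>l\<le>n. F $ l * (B ^ l * T) $ n)"
proof -
  have "(F oo B) $ j = (\<Sum>l\<le>n. F $ l * (B ^ l) $ j)" if "j \<le> n" for j
    unfolding fps_compose_nth using that assms
    by (intro sum.mono_neutral_left) (auto simp: startsby_zero_power_prefix)
  then have "((F oo B) * T) $ n = (\<Sum>j=0..n. \<Sum>l\<le>n. F $ l * ((B ^ l) $ j * T $ (n - j)))"
    by (simp add: fps_mult_nth sum_distrib_right mult.assoc)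
  also have "\<dots> = (\<Sum>l\<le>n. F $ l * (B ^ l * T) $ n)"
    by (subst sum.swap) (simp add: fps_mult_nth sum_distrib_left)
  finally show ?thesis .
qed

lemma block_recursion_functional_equation:
  assumes G: "block_recursion (fps_nth F) h k G" and "G 0 = 1"
  shows "G 1 = (F oo (fps_X ^ 2 * G 1 ^ k)) * (1 + fps_X * G 1 ^ h)"
proof (rule fps_ext)
  fix n
  \<comment> \<open>By \<open>G p = G 1 ^ p\<close> the summand is the \<open>l\<close>-th power of
    one series times a factor free of \<open>l\<close>, so the sum over \<open>l\<close> is a
    composition.\<close>
  have summand: "fps_X ^ (2 * l) * (G (k * l) + fps_X * G (k * l + h)) =
      (fps_X ^ 2 * G 1 ^ k) ^ l * (1 + fps_X * G 1 ^ h)" for l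
  proof -
    have "G (k * l) = (G 1 ^ k) ^ l" "G (k * l + h) = (G 1 ^ k) ^ l * G 1 ^ h"
      by (simp_all only: block_recursion_power[OF assms, of "k * l"]
            block_recursion_power[OF assms, of "k * l + h"] power_mult power_add)
    then show ?thesis
      by (simp add: power_mult_distrib distrib_left mult_ac del: One_nat_def flip: power_mult)
  qed
  have "G 1 $ n = (\<Sum>l\<le>n. F $ l * (fps_X ^ (2 * l) * (G (k * l) + fps_X * G (k * l + h))) $ n)"
    using G[unfolded block_recursion_def, rule_format, of 0 n] by simp
  also have "\<dots> = (\<Sum>l\<le>n. F $ l * ((fps_X ^ 2 * G 1 ^ k) ^ l * (1 + fps_X * G 1 ^ h)) $ n)"
    by (simp only: summand)
  finally show "G 1 $ n = ((F oo (fps_X ^ 2 * G 1 ^ k)) * (1 + fps_X * G 1 ^ h)) $ n"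
    by (simp add: fps_compose_mult_nth)
qed

subsection \<open>The explicit solution\<close>

text \<open>Coefficient of \<open>x^i\<close> in \<open>x (F^(m+1))' = (m+1) (x F') F^m\<close>. It
  evaluates convolutions weighted by \<open>l\<close>.\<close>

lemma fps_power_Suc_nth_weighted:
  fixes F :: "'a::{field_char_0} fps"
  shows "of_nat (Suc m) * (\<Sum>l\<le>i. of_nat l * F $ l * (F ^ m) $ (i - l)) = of_nat i * (F ^ Suc m) $ i"
proof -
  have X_deriv: "(fps_X * fps_deriv A) $ j = of_nat j * A $ j" for A :: "'a fps" and j
    by (cases j) auto
  have "fps_X * fps_deriv (F ^ Suc m) = of_nat (Suc m) * ((fps_X * fps_deriv F) * F ^ m)"
    unfolding fps_deriv_power' by (simp only: diff_Suc_1 mult_ac)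
  then have "of_nat i * (F ^ Suc m) $ i = of_nat (Suc m) * ((fps_X * fps_deriv F) * F ^ m) $ i"
    by (metis X_deriv fps_mult_of_nat_nth(1))
  then show ?thesis
    by (simp only: fps_mult_nth[of "fps_X * fps_deriv F"] X_deriv atLeast0AtMost)
qed

text \<open>
  For \<open>k = 2 h - 1\<close> and \<open>n = 2 i + b\<close> the exponent \<open>p + k i + h b\<close> is \<open>h n - i + p\<close>.
\<close>
definition lagrange_term ::
    "'a::field_char_0 fps \<Rightarrow> nat \<Rightarrow> nat \<Rightarrow> nat \<Rightarrow> nat \<Rightarrow> nat \<Rightarrow> 'a" where
  "lagrange_term F h k p i b =
     of_nat p / of_nat (p + k * i + h * b) * of_nat ((p + k * i + h * b) choose b)
     * (F ^ (p + k * i + h * b)) $ i"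

text \<open>All terms on the right share the exponent \<open>m = p + k i + h b\<close>, and their
  prefactors are affine in \<open>l\<close>. The sum thus reduces to the plain convolution
  \<open>S\<close> and the weighted one \<open>W\<close>.\<close>

lemma lagrange_term_Suc:
  assumes "p + k * i + h * b > 0"
  shows "lagrange_term F h k (Suc p) i b =
    (\<Sum>l\<le>i. F $ l * (lagrange_term F h k (p + k * l) (i - l) b +
       (if b = 0 then 0 else lagrange_term F h k (p + k * l + h) (i - l) (b - 1))))"
proof -
  define m where "m = p + k * i + h * b"
  define C :: 'a where "C = of_nat (Suc m choose b)"
  \<comment> \<open>The value 0 at \<open>b = 0\<close> stands for \<open>binom(m, -1)\<close>, so
    Pascal's rule and absorption hold for all \<open>b\<close>.\<close>
  define B :: 'a where "B = (if b = 0 then 0 else of_nat (m choose (b - 1)))"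
  define S where "S = (F ^ Suc m) $ i"
  define W where "W = (\<Sum>l\<le>i. of_nat l * F $ l * (F ^ m) $ (i - l))"
  have m: "of_nat m = (of_nat p + of_nat k * of_nat i + of_nat h * of_nat b :: 'a)"
    by (simp add: m_def)
  have "of_nat m \<noteq> (0 :: 'a)" "of_nat (Suc m) \<noteq> (0 :: 'a)"
    using assms unfolding m_def[symmetric] of_nat_eq_0_iff by simp_all
  then have m0: "of_nat m \<noteq> (0 :: 'a)" "of_nat m + 1 \<noteq> (0 :: 'a)"
    by (simp_all add: add.commute)
  have S: "S = (\<Sum>l\<le>i. F $ l * (F ^ m) $ (i - l))"
    by (simp add: S_def fps_mult_nth atLeast0AtMost)
  have W: "(of_nat m + 1) * W = of_nat i * S"
    using fps_power_Suc_nth_weighted[of m F i] by (simp add: W_def S_def add.commute)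
  have C: "of_nat (m choose b) = C - B"
    by (cases b) (simp_all add: C_def B_def)
  have B: "(of_nat m + 1) * B = of_nat b * C"
  proof (cases b)
    case (Suc b')
    have "Suc m * (m choose b') = (Suc m choose b) * b"
      using Suc_times_binomial_eq[of m b'] Suc by simp
    then have "of_nat (Suc m) * of_nat (m choose b') = (C * of_nat b :: 'a)"
      unfolding C_def of_nat_mult[symmetric] by simp
    then show ?thesis using Suc by (simp add: B_def algebra_simps)
  qed (simp add: B_def)
  have "lagrange_term F h k (p + k * l) (i - l) b +
      (if b = 0 then 0 else lagrange_term F h k (p + k * l + h) (i - l) (b - 1)) =
      (of_nat (p + k * l) * C + of_nat h * B) / of_nat m * (F ^ m) $ (i - l)" if "l \<le> i" for l
  proof -
    have k: "k * i = k * l + k * (i - l)"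
      using that by (simp flip: add_mult_distrib2)
    have "p + k * l + k * (i - l) + h * b = m"
      by (simp add: m_def k)
    then have 1: "lagrange_term F h k (p + k * l) (i - l) b =
        of_nat (p + k * l) / of_nat m * (C - B) * (F ^ m) $ (i - l)"
      by (simp only: lagrange_term_def C)
    have 2: "(if b = 0 then 0 else lagrange_term F h k (p + k * l + h) (i - l) (b - 1)) =
        of_nat (p + k * l + h) / of_nat m * B * (F ^ m) $ (i - l)"
    proof (cases "b = 0")
      case False
      then have "p + k * l + h + k * (i - l) + h * (b - 1) = m"
        by (cases b) (simp_all add: m_def k)
      then show ?thesis
        using False by (simp only: lagrange_term_def B_def if_False)
    qed (simp add: B_def)
    have "of_nat (p + k * l + h) = (of_nat (p + k * l) + of_nat h :: 'a)"
      by simp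
    then show ?thesis
      unfolding 1 2 using m0(1) by (simp only:) (simp add: field_simps del: of_nat_add of_nat_mult)
  qed
  then have "(\<Sum>l\<le>i. F $ l * (lagrange_term F h k (p + k * l) (i - l) b +
       (if b = 0 then 0 else lagrange_term F h k (p + k * l + h) (i - l) (b - 1)))) =
      (\<Sum>l\<le>i. F $ l * ((of_nat (p + k * l) * C + of_nat h * B) / of_nat m * (F ^ m) $ (i - l)))"
    by (intro sum.cong) auto
  also have "\<dots> = ((of_nat p * C + of_nat h * B) * S + of_nat k * C * W) / of_nat m"
    unfolding S W_def sum_distrib_left sum_divide_distrib sum.distrib[symmetric]
    by (intro sum.cong) (simp_all add: field_simps add_divide_distrib)
  \<comment> \<open>After multiplication by \<open>m + 1\<close> the numerator is
    \<open>(p (m + 1) + h b + k i) C S\<close>, and \<open>p + h b + k i = m\<close> turns the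
    bracket into \<open>(p + 1) m\<close>.\<close>
  also have "\<dots> = of_nat (Suc p) / of_nat (Suc m) * C * S"
  proof -
    have "(of_nat m + 1) * ((of_nat p * C + of_nat h * B) * S + of_nat k * C * W) =
        (of_nat m + 1) * of_nat p * C * S + of_nat h * ((of_nat m + 1) * B) * S
          + of_nat k * C * ((of_nat m + 1) * W)"
      by (simp add: algebra_simps)
    also have "\<dots> = (of_nat p + 1) * C * S * of_nat m"
      unfolding B W by (simp add: m algebra_simps)
    finally show ?thesis
      using m0 by (simp add: field_simps)
  qed
  also have "\<dots> = lagrange_term F h k (Suc p) i b"
    by (simp add: lagrange_term_def m_def C_def S_def)
  finally show ?thesis by simp
qed

text \<open>
  The constant coefficient is set separately because the formula would give \<open>0 / 0\<close> for \<open>p = 0\<close>.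
\<close>
definition lagrange_series :: "'a::field_char_0 fps \<Rightarrow> nat \<Rightarrow> nat \<Rightarrow> nat \<Rightarrow> 'a fps" where
  "lagrange_series F h k p =
     Abs_fps (\<lambda>n. if n = 0 then 1 else \<Sum>i\<le>n div 2. lagrange_term F h k p i (n - 2 * i))"

lemma lagrange_series_nth:
  assumes "F $ 0 = 1" "p > 0 \<or> n > 0"
  shows "lagrange_series F h k p $ n = (\<Sum>i\<le>n div 2. lagrange_term F h k p i (n - 2 * i))"
  using assms by (auto simp: lagrange_series_def lagrange_term_def fps_power_zeroth)

text \<open>The right side is a double sum over the block length \<open>l\<close> and a remaining
  index \<open>i\<close>. Grouping by \<open>l + i\<close> leaves one instance of
  \<open>lagrange_term_Suc\<close> per total.\<close>

lemma block_recursion_lagrange_series: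
  assumes F: "F $ 0 = 1" and "h > 0" "k > 0"
  shows "block_recursion (fps_nth F) h k (lagrange_series F h k)"
  unfolding block_recursion_def
proof (intro allI)
  fix p n
  let ?L = "lagrange_series F h k" and ?t = "lagrange_term F h k"
  show "?L (Suc p) $ n =
      (\<Sum>l\<le>n. F $ l * (fps_X ^ (2 * l) * (?L (p + k * l) + fps_X * ?L (p + k * l + h))) $ n)"
  proof (cases "n = 0")
    case True
    then show ?thesis by (simp add: lagrange_series_def F)
  next
    case False
    define R where "R l i = F $ l * (?t (p + k * l) i (n - 2 * (l + i)) +
        (if n - 2 * (l + i) = 0 then 0 else ?t (p + k * l + h) i (n - 2 * (l + i) - 1)))" for l i
    have inner: "F $ l * (fps_X ^ (2 * l) * (?L (p + k * l) + fps_X * ?L (p + k * l + h))) $ n =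
        (\<Sum>i\<le>n div 2 - l. R l i)" if "l \<le> n div 2" for l
    proof -
      have half: "(n - 2 * l) div 2 = n div 2 - l" by simp
      \<comment> \<open>Excludes the one coefficient that is set by hand.\<close>
      have pos: "p + k * l > 0 \<or> n - 2 * l > 0"
        using False \<open>k > 0\<close> by (cases "l = 0") simp_all
      have "?L (p + k * l) $ (n - 2 * l) =
          (\<Sum>i\<le>n div 2 - l. ?t (p + k * l) i (n - 2 * (l + i)))"
        by (simp only: lagrange_series_nth[OF F pos] half add_mult_distrib2 diff_diff_left)
      moreover have "(if n - 2 * l = 0 then 0 else ?L (p + k * l + h) $ (n - 2 * l - 1)) =
          (\<Sum>i\<le>n div 2 - l. if n - 2 * (l + i) = 0 then 0
             else ?t (p + k * l + h) i (n - 2 * (l + i) - 1))"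
      proof (cases "n - 2 * l = 0")
        case False
        then have "?L (p + k * l + h) $ (n - 2 * l - 1) =
            (\<Sum>i\<le>(n - 2 * l - 1) div 2. ?t (p + k * l + h) i (n - 2 * l - 1 - 2 * i))"
          using lagrange_series_nth[OF F, of "p + k * l + h" "n - 2 * l - 1" h k] \<open>h > 0\<close> by simp
        \<comment> \<open>For even \<open>n\<close> the range gains \<open>i = n div 2 - l\<close>,
          where the \<open>if\<close> gives 0: no level step is left.\<close>
        also have "\<dots> = (\<Sum>i\<le>n div 2 - l. if n - 2 * (l + i) = 0 then 0
             else ?t (p + k * l + h) i (n - 2 * (l + i) - 1))"
          using False
          by (intro sum.mono_neutral_cong_left) (auto simp: algebra_simps)
        finally show ?thesis using False by simp
      qed auto
      moreover have "\<not> n < 2 * l" using that by linarith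
      ultimately show ?thesis
        by (simp add: fps_X_power_mult_nth R_def sum_distrib_left distrib_left sum.distrib)
    qed
    have "?L (Suc p) $ n = (\<Sum>i\<le>n div 2. \<Sum>l\<le>i. R l (i - l))"
      unfolding lagrange_series_nth[OF F disjI2[OF \<open>n \<noteq> 0\<close>[unfolded neq0_conv]]]
    proof (intro sum.cong refl)
      fix i assume "i \<in> {..n div 2}"
      have "p + k * i + h * (n - 2 * i) > 0"
        using False \<open>h > 0\<close> \<open>k > 0\<close> by (cases "i = 0") auto
      then show "?t (Suc p) i (n - 2 * i) = (\<Sum>l\<le>i. R l (i - l))"
        unfolding lagrange_term_Suc[OF \<open>p + k * i + h * (n - 2 * i) > 0\<close>] R_def
        by (intro sum.cong) auto
    qed
    also have "\<dots> = (\<Sum>(l, i)\<in>{(l, i). l + i \<le> n div 2}. R l i)"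
      by (rule sum.triangle_reindex_eq[symmetric])
    also have "{(l, i). l + i \<le> n div 2} = Sigma {..n div 2} (\<lambda>l. {..n div 2 - l})"
      by auto
    also have "(\<Sum>(l, i)\<in>\<dots>. R l i) = (\<Sum>l\<le>n div 2. \<Sum>i\<le>n div 2 - l. R l i)"
      by (rule sum.Sigma[symmetric]) auto
    also have "\<dots> = (\<Sum>l\<le>n div 2. F $ l *
        (fps_X ^ (2 * l) * (?L (p + k * l) + fps_X * ?L (p + k * l + h))) $ n)"
      by (intro sum.cong) (simp_all add: inner)
    also have "\<dots> = (\<Sum>l\<le>n. F $ l *
        (fps_X ^ (2 * l) * (?L (p + k * l) + fps_X * ?L (p + k * l + h))) $ n)"
      by (intro sum.mono_neutral_left) (auto simp: fps_X_power_mult_nth)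
    finally show ?thesis .
  qed
qed

lemma lagrange_series_0: "lagrange_series F h k 0 = 1"
  by (auto simp: lagrange_series_def lagrange_term_def fps_eq_iff)

subsection \<open>Splitting off the first block of a path\<close>

definition block_weight :: "(nat \<Rightarrow> 'a::comm_monoid_mult) \<Rightarrow> 's \<Rightarrow> 's list \<Rightarrow> 'a" where
  "block_weight f s M = prod_list (map f (block_lengths s M))"

lemma block_weight_Nil [simp]: "block_weight f s [] = 1"
  by (simp add: block_weight_def)

text \<open>The step \<open>t\<close> ends the block, so no block of \<open>M\<close> merges with
  it. For \<open>l = 0\<close> there is no block, and the factor is the constant coefficient of
  \<open>F\<close>.\<close>

lemma block_weight_block:
  assumes "t \<noteq> s"
  shows "block_weight f s (replicate l s @ t # M) = (if l = 0 then 1 else f l) * block_weight f s M"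
proof (cases l)
  case (Suc l')
  have "takeWhile (\<lambda>y. y = s) (replicate l' s @ t # M) = replicate l' s"
       "dropWhile (\<lambda>y. y = s) (replicate l' s @ t # M) = t # M"
    using assms by (simp_all add: takeWhile_append dropWhile_append)
  then show ?thesis
    using Suc assms by (simp add: block_weight_def)
qed (use assms in \<open>simp add: block_weight_def\<close>)

text \<open>\<open>l\<close> is the length of the initial run of \<open>s\<close>. This uniqueness
  makes the later partition of the paths disjoint.\<close>

lemma replicate_append_Cons_inject:
  assumes "t \<noteq> s" "t' \<noteq> s"
  shows "replicate l s @ t # M = replicate l' s @ t' # M' \<longleftrightarrow> l = l' \<and> t = t' \<and> M = M'"
proof
  assume eq: "replicate l s @ t # M = replicate l' s @ t' # M'"
  have "takeWhile (\<lambda>y. y = s) (replicate l s @ t # M) = replicate l s"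
       "takeWhile (\<lambda>y. y = s) (replicate l' s @ t' # M') = replicate l' s"
    using assms by (simp_all add: takeWhile_append)
  then have "l = l'" using eq by (metis length_replicate)
  then show "l = l' \<and> t = t' \<and> M = M'" using eq by simp
qed simp

lemma list_eq_replicate_or_append_Cons:
  obtains l where "xs = replicate l s" | l t M where "t \<noteq> s" "xs = replicate l s @ t # M"
proof (induction xs arbitrary: thesis)
  case Nil
  show ?case using Nil(1)[of 0] by simp
next
  case (Cons x xs)
  show ?case
  proof (cases "x = s")
    case False
    then show ?thesis using Cons(3)[of x 0 xs] by simp
  next
    case True
    show ?thesis
    proof (rule Cons(1))
      fix l assume "xs = replicate l s"
      then show ?thesis using Cons(2)[of "Suc l"] True by simp
    next
      fix l t M assume "t \<noteq> s" "xs = replicate l s @ t # M"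
      then show ?thesis using Cons(3)[of t "Suc l" M] True by simp
    qed
  qed
qed

section \<open>Paths from an arbitrary height to the axis\<close>

definition stays_nonneg :: "int \<Rightarrow> (int \<times> int) list \<Rightarrow> bool" where
  "stays_nonneg a M \<longleftrightarrow> (\<forall>j\<le>length M. 0 \<le> a + snd (sum_list (take j M)))"

lemma stays_nonneg_Nil [simp]: "stays_nonneg a [] \<longleftrightarrow> 0 \<le> a"
  by (simp add: stays_nonneg_def)

lemma stays_nonneg_Cons [simp]:
  "stays_nonneg a (x # M) \<longleftrightarrow> 0 \<le> a \<and> stays_nonneg (a + snd x) M"
proof -
  have "stays_nonneg a (x # M) \<longleftrightarrow>
      (\<forall>j\<in>{..Suc (length M)}. 0 \<le> a + snd (sum_list (take j (x # M))))"
    by (auto simp: stays_nonneg_def)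
  also have "{..Suc (length M)} = insert 0 (Suc ` {..length M})"
    by (rule atMost_Suc_eq_insert_0)
  finally show ?thesis
    by (auto simp: stays_nonneg_def add.assoc)
qed

lemma stays_nonneg_imp_nonneg: "stays_nonneg a M \<Longrightarrow> 0 \<le> a"
  by (cases M) auto

lemma stays_nonneg_replicate_append:
  assumes "0 \<le> a"
  shows "stays_nonneg a (replicate l (1, int k) @ M) \<longleftrightarrow> stays_nonneg (a + int (k * l)) M"
  using assms
proof (induction l arbitrary: a)
  case (Suc l)
  then show ?case by (simp add: algebra_simps)
qed simp

lemma sum_list_replicate_up: "sum_list (replicate l (1, int k)) = (int l, int (k * l))"
  by (induction l) (simp_all add: zero_prod_def algebra_simps)

text \<open>
  The paths from height \<open>q\<close> to \<open>0\<close> with \<open>n = 2 a + b\<close>, where \<open>a\<close> and \<open>b\<close> count the up and the level steps.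
\<close>
definition descents :: "nat \<Rightarrow> nat \<Rightarrow> nat \<Rightarrow> (int \<times> int) list set" where
  "descents k q n =
     {M. set M \<subseteq> motzkin_steps k \<and>
         sum_list M = (int ((k + 1) div 2 * n + q), - int q) \<and> stays_nonneg (int q) M}"

lemma descents_0: "descents k 0 n = motzkin_paths k n"
  by (simp add: descents_def motzkin_paths_def stays_nonneg_def)

lemma fst_sum_list_motzkin_steps:
  "set M \<subseteq> motzkin_steps k \<Longrightarrow> fst (sum_list M) = int (length M)"
  by (induction M) (auto simp: motzkin_steps_def)

text \<open>Each step moves right by one and falls by at most one. This limits how high an initial
  block can climb.\<close>

lemma snd_sum_list_motzkin_steps:
  "set M \<subseteq> motzkin_steps k \<Longrightarrow> - fst (sum_list M) \<le> snd (sum_list M)"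
  by (induction M) (auto simp: motzkin_steps_def)

lemma finite_descents: "finite (descents k q n)"
proof (rule finite_subset)
  show "descents k q n \<subseteq>
      {M. set M \<subseteq> motzkin_steps k \<and> length M = (k + 1) div 2 * n + q}"
  proof
    fix M assume M: "M \<in> descents k q n"
    then have "int (length M) = int ((k + 1) div 2 * n + q)"
      using fst_sum_list_motzkin_steps[of M k] by (simp add: descents_def)
    then show "M \<in> {M. set M \<subseteq> motzkin_steps k \<and> length M = (k + 1) div 2 * n + q}"
      using M by (simp only: of_nat_eq_iff) (simp add: descents_def)
  qed
  show "finite {M. set M \<subseteq> motzkin_steps k \<and> length M = (k + 1) div 2 * n + q}"
    by (rule finite_lists_length_eq) (simp add: motzkin_steps_def)
qed

text \<open>The removed part has \<open>l + 1\<close> steps and ends at height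
  \<open>q + k l - 1\<close>. The remaining length fits \<open>n - 2 l\<close> because
  \<open>2 ((k + 1) div 2) = k + 1\<close>.\<close>

lemma descents_block_down:
  assumes "odd k"
  shows "replicate l (1, int k) @ (1, - 1) # M \<in> descents k q n \<longleftrightarrow>
         q + k * l > 0 \<and> 2 * l \<le> n \<and> M \<in> descents k (q + k * l - 1) (n - 2 * l)"
proof -
  obtain h where k: "k = 2 * h + 1" using assms by (elim oddE)
  have sum: "sum_list (replicate l (1, int k) @ (1, - 1) # M) =
      (int (l + 1) + fst (sum_list M), int (k * l) - 1 + snd (sum_list M))"
    by (simp add: sum_list_replicate_up prod_eq_iff)
  have steps: "set (replicate l (1, int k) @ (1, - 1) # M) \<subseteq> motzkin_steps k \<longleftrightarrow>
      set M \<subseteq> motzkin_steps k"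
    by (auto simp: motzkin_steps_def)
  have nonneg: "stays_nonneg (int q) (replicate l (1, int k) @ (1, - 1) # M) \<longleftrightarrow>
      stays_nonneg (int (q + k * l) - 1) M"
    by (simp add: stays_nonneg_replicate_append)
  \<comment> \<open>Guards the truncated \<open>n - 2 * l\<close>: the rest of the path must be at
    least as long as the height it has to lose.\<close>
  have n: "2 * l \<le> n" if "set M \<subseteq> motzkin_steps k"
    "sum_list (replicate l (1, int k) @ (1, - 1) # M) = (int ((k + 1) div 2 * n + q), - int q)"
  proof -
    have "int (2 * (h + 1) * l) \<le> int ((h + 1) * n)"
      using snd_sum_list_motzkin_steps[OF that(1)] that(2) unfolding sum by (simp add: k algebra_simps)
    then have "(h + 1) * (2 * l) \<le> (h + 1) * n"
      by (simp only: of_nat_le_iff mult_ac)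
    then show ?thesis by (simp only: mult_le_cancel1)
  qed
  have pos: "q + k * l > 0" if "stays_nonneg (int (q + k * l) - 1) M"
    using stays_nonneg_imp_nonneg[OF that] by linarith
  show ?thesis
  proof (cases "q + k * l > 0 \<and> 2 * l \<le> n")
    case False
    then show ?thesis using n pos steps nonneg by (auto simp: descents_def)
  next
    case True
    obtain n' where n': "n = n' + 2 * l" using True by (metis le_add_diff_inverse2)
    have q': "int (q + k * l - 1) = int (q + k * l) - 1" 
      using True by (intro of_nat_diff[where n = 1, simplified of_nat_1]) linarith
    have eq: "sum_list (replicate l (1, int k) @ (1, - 1) # M) = (int ((k + 1) div 2 * n + q), - int q) \<longleftrightarrow>
        sum_list M = (int ((k + 1) div 2 * (n - 2 * l) + (q + k * l - 1)), - int (q + k * l - 1))"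
      unfolding sum of_nat_add q' by (auto simp: n' k prod_eq_iff algebra_simps)
    show ?thesis
      unfolding descents_def mem_Collect_eq eq steps nonneg q' by (simp only: True simp_thms)
  qed
qed

text \<open>Here \<open>n\<close> drops by one more: the level step itself and its rise
  \<open>(k - 1) / 2\<close> add up to \<open>(k + 1) / 2\<close>.\<close>

lemma descents_block_level:
  assumes "odd k"
  shows "replicate l (1, int k) @ (1, int ((k - 1) div 2)) # M \<in> descents k q n \<longleftrightarrow>
         2 * l < n \<and> M \<in> descents k (q + k * l + (k - 1) div 2) (n - 2 * l - 1)"
proof -
  obtain h where k: "k = 2 * h + 1" using assms by (elim oddE)
  have half: "(k - 1) div 2 = h" by (simp add: k)
  have sum: "sum_list (replicate l (1, int k) @ (1, int ((k - 1) div 2)) # M) =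
      (int (l + 1) + fst (sum_list M), int (k * l) + int h + snd (sum_list M))"
    using half by (simp add: sum_list_replicate_up prod_eq_iff)
  have steps: "set (replicate l (1, int k) @ (1, int ((k - 1) div 2)) # M) \<subseteq> motzkin_steps k \<longleftrightarrow>
      set M \<subseteq> motzkin_steps k"
    by (auto simp: motzkin_steps_def)
  have nonneg: "stays_nonneg (int q) (replicate l (1, int k) @ (1, int ((k - 1) div 2)) # M) \<longleftrightarrow>
      stays_nonneg (int (q + k * l + (k - 1) div 2)) M"
    by (simp add: stays_nonneg_replicate_append)
  have n: "2 * l < n" if "set M \<subseteq> motzkin_steps k"
    "sum_list (replicate l (1, int k) @ (1, int ((k - 1) div 2)) # M) =
       (int ((k + 1) div 2 * n + q), - int q)"
  proof -
    have "int (2 * (h + 1) * l + (h + 1)) \<le> int ((h + 1) * n)"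
      using snd_sum_list_motzkin_steps[OF that(1)] that(2) unfolding sum by (simp add: k algebra_simps)
    then have "(h + 1) * (2 * l + 1) \<le> (h + 1) * n"
      by (simp only: of_nat_le_iff algebra_simps)
    then show ?thesis by (simp only: mult_le_cancel1) simp
  qed
  show ?thesis
  proof (cases "2 * l < n")
    case False
    then show ?thesis using n steps nonneg by (auto simp: descents_def)
  next
    case True
    obtain n' where n': "n = Suc n' + 2 * l"
      using True by (metis add.commute add_Suc_right less_imp_Suc_add)
    have "sum_list (replicate l (1, int k) @ (1, int ((k - 1) div 2)) # M) =
          (int ((k + 1) div 2 * n + q), - int q) \<longleftrightarrow>
        sum_list M = (int ((k + 1) div 2 * (n - 2 * l - 1) + (q + k * l + (k - 1) div 2)),
          - int (q + k * l + (k - 1) div 2))"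
      unfolding sum by (auto simp: n' k prod_eq_iff algebra_simps)
    then show ?thesis using True nonneg steps by (simp add: descents_def)
  qed
qed

text \<open>A nonempty run of up steps ends strictly above its start, hence not on the axis. So only
  the empty path has no step after its initial block.\<close>

lemma replicate_in_descents_iff:
  assumes "k > 0"
  shows "replicate l (1, int k) \<in> descents k q n \<longleftrightarrow> l = 0 \<and> q = 0 \<and> n = 0"
proof
  assume M: "replicate l (1, int k) \<in> descents k q n"
  then have eq: "int l = int ((k + 1) div 2 * n + q)" "int (k * l) = - int q"
    unfolding descents_def mem_Collect_eq sum_list_replicate_up prod.inject by blast+
  then have "k * l = 0" "q = 0" by linarith+
  with eq(1) assms show "l = 0 \<and> q = 0 \<and> n = 0" by auto
qed (simp add: descents_def zero_prod_def)

section \<open>The weighted path series solve the block recursion\<close>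

definition descent_series :: "(nat \<Rightarrow> 'a::comm_ring_1) \<Rightarrow> nat \<Rightarrow> nat \<Rightarrow> 'a fps" where
  "descent_series f k p = (case p of 0 \<Rightarrow> 1
     | Suc q \<Rightarrow> Abs_fps (\<lambda>n. \<Sum>M\<in>descents k q n. block_weight f (1, int k) M))"

lemma block_recursion_descent_series:
  assumes "odd k"
  shows "block_recursion (\<lambda>l. if l = 0 then 1 else f l) ((k + 1) div 2) k (descent_series f k)"
  unfolding block_recursion_def
proof (intro allI)
  fix q n
  let ?c = "\<lambda>l. if l = 0 then 1 else f l"
  let ?w = "block_weight f (1, int k)"
  let ?S = "descent_series f k"
  let ?h = "(k + 1) div 2"
  define down where "down l M = replicate l (1, int k) @ (1 :: int, - 1 :: int) # M" for l M
  define level where "level l M = replicate l (1, int k) @ (1 :: int, int ((k - 1) div 2)) # M" for l M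
  \<comment> \<open>\<open>q + k * l = 0\<close> would mean a down step from the axis, which is only
    the imagined final one; the empty path then matches
    \<open>descent_series f k 0 = 1\<close>.\<close>
  define D where "D l = (if n < 2 * l then {} else case q + k * l of
      0 \<Rightarrow> if n = 0 then {[]} else {}
    | Suc r \<Rightarrow> down l ` descents k r (n - 2 * l))" for l
  define L where "L l = (if 2 * l < n
      then level l ` descents k (q + k * l + (k - 1) div 2) (n - 2 * l - 1) else {})" for l
  have "k > 0" using assms by (rule odd_pos)
  have steps: "(1, - 1) \<noteq> (1, int k)" "(1, int ((k - 1) div 2)) \<noteq> (1, int k)"
    "- 1 \<noteq> int ((k - 1) div 2)"
    using \<open>k > 0\<close> by (auto simp: prod_eq_iff)
  have inject: "down l M = down l' M' \<longleftrightarrow> l = l' \<and> M = M'"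
    "level l M = level l' M' \<longleftrightarrow> l = l' \<and> M = M'" "down l M \<noteq> level l' M'"
    "level l M \<noteq> down l' M'" "down l M \<noteq> []" "level l M \<noteq> []" for l l' M M'
    unfolding down_def level_def
    by (auto simp only: replicate_append_Cons_inject[OF steps(1) steps(1)]
        replicate_append_Cons_inject[OF steps(2) steps(2)]
        replicate_append_Cons_inject[OF steps(1) steps(2)]
        replicate_append_Cons_inject[OF steps(2) steps(1)]
        steps(3) steps(3)[symmetric] prod.inject append_is_Nil_conv list.distinct)
  have weight: "?w (down l M) = ?c l * ?w M" "?w (level l M) = ?c l * ?w M" for l M
    unfolding down_def level_def by (rule block_weight_block steps)+
  have "descents k q n = (\<Union>l\<le>n. D l \<union> L l)"
  proof (intro equalityI subsetI)
    fix M assume M: "M \<in> descents k q n"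
    show "M \<in> (\<Union>l\<le>n. D l \<union> L l)"
    proof (cases M rule: list_eq_replicate_or_append_Cons[where s = "(1, int k)"])
      case (1 l)
      then show ?thesis
        using M replicate_in_descents_iff[OF \<open>k > 0\<close>] by (auto simp: D_def)
    next
      case (2 l t M')
      then have "t = (1, - 1) \<or> t = (1, int ((k - 1) div 2))"
        using M by (auto simp: descents_def motzkin_steps_def)
      then show ?thesis
      proof
        assume t: "t = (1, - 1)"
        then have "q + k * l > 0" "2 * l \<le> n" "M' \<in> descents k (q + k * l - 1) (n - 2 * l)"
          using M descents_block_down[OF assms] 2 by auto
        then have "M \<in> D l"
          using 2 t by (auto simp: D_def down_def split: nat.split)
        then show ?thesis using \<open>2 * l \<le> n\<close> by auto
      next
        assume t: "t = (1, int ((k - 1) div 2))"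
        then have "2 * l < n" "M' \<in> descents k (q + k * l + (k - 1) div 2) (n - 2 * l - 1)"
          using M descents_block_level[OF assms] 2 by auto
        then have "M \<in> L l"
          using 2 t by (auto simp: L_def level_def)
        then show ?thesis using \<open>2 * l < n\<close> by auto
      qed
    qed
  next
    fix M assume "M \<in> (\<Union>l\<le>n. D l \<union> L l)"
    then obtain l where "M \<in> D l \<or> M \<in> L l" by blast
    then show "M \<in> descents k q n"
    proof
      assume M: "M \<in> D l"
      show ?thesis
      proof (cases "q + k * l")
        case 0
        then have "M = []" "n = 0" "q = 0"
          using M unfolding D_def by (simp_all only: nat.case) (simp_all split: if_splits)
        then show ?thesis
          using replicate_in_descents_iff[OF \<open>k > 0\<close>, of 0 0 0] by simp
      next
        case (Suc r)
        then obtain M' where "2 * l \<le> n" "M = down l M'" "M' \<in> descents k r (n - 2 * l)"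
          using M by (auto simp: D_def split: if_splits)
        then show ?thesis
          using Suc unfolding down_def by (simp only: descents_block_down[OF assms]) simp
      qed
    next
      assume "M \<in> L l"
      then show ?thesis
        using descents_block_level[OF assms, of l _ q n]
        by (auto simp: L_def level_def split: if_splits)
    qed
  qed
  then have "?S (Suc q) $ n = (\<Sum>M\<in>(\<Union>l\<le>n. D l \<union> L l). ?w M)"
    by (simp add: descent_series_def)
  also have "\<dots> = (\<Sum>l\<le>n. \<Sum>M\<in>D l \<union> L l. ?w M)"
    by (rule sum.UNION_disjoint)
      (auto simp: D_def L_def finite_descents inject \<open>k > 0\<close> split: if_splits nat.splits)
  also have "\<dots> = (\<Sum>l\<le>n. (\<Sum>M\<in>D l. ?w M) + (\<Sum>M\<in>L l. ?w M))"
    by (intro sum.cong refl sum.union_disjoint)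
      (auto simp: D_def L_def finite_descents inject split: if_splits nat.splits)
  also have "\<dots> = (\<Sum>l\<le>n. ?c l * (fps_X ^ (2 * l) * (?S (q + k * l) + fps_X * ?S (q + k * l + ?h))) $ n)"
  proof (intro sum.cong refl)
    fix l
    have down: "(\<Sum>M\<in>D l. ?w M) = (if n < 2 * l then 0 else ?c l * ?S (q + k * l) $ (n - 2 * l))"
    proof (cases "q + k * l")
      case 0
      then show ?thesis using \<open>k > 0\<close> by (auto simp: D_def descent_series_def)
    next
      case (Suc r)
      have "(\<Sum>M\<in>down l ` A. ?w M) = ?c l * (\<Sum>M\<in>A. ?w M)" for A
        by (subst sum.reindex) (auto simp: inj_on_def inject weight sum_distrib_left)
      then show ?thesis using Suc by (simp add: D_def descent_series_def)
    qed
    \<comment> \<open>The index of the series is one more than the starting height.\<close>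
    have h: "q + k * l + ?h = Suc (q + k * l + (k - 1) div 2)"
      using assms by (auto elim: oddE)
    have "(\<Sum>M\<in>level l ` A. ?w M) = ?c l * (\<Sum>M\<in>A. ?w M)" for A
      by (subst sum.reindex) (auto simp: inj_on_def inject weight sum_distrib_left)
    then have level: "(\<Sum>M\<in>L l. ?w M) =
        (if 2 * l < n then ?c l * ?S (q + k * l + ?h) $ (n - 2 * l - 1) else 0)"
      unfolding h by (simp add: L_def descent_series_def)
    show "(\<Sum>M\<in>D l. ?w M) + (\<Sum>M\<in>L l. ?w M) =
        ?c l * (fps_X ^ (2 * l) * (?S (q + k * l) + fps_X * ?S (q + k * l + ?h))) $ n"
      unfolding down level by (auto simp: fps_X_power_mult_nth distrib_left)
  qed
  finally show "?S (Suc q) $ n =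
      (\<Sum>l\<le>n. ?c l * (fps_X ^ (2 * l) * (?S (q + k * l) + fps_X * ?S (q + k * l + ?h))) $ n)" .
qed

section \<open>Comparison of the two solutions\<close>

lemma motzkin_sum_eq_descent_series: "motzkin_sum f k n = descent_series f k 1 $ n"
  by (simp add: motzkin_sum_def descent_series_def descents_0 block_weight_def up_blocks_def
      prod.list_conv_set_nth atLeast0LessThan)

theorem theorem5p1:
  fixes f :: "nat \<Rightarrow> complex" and k :: nat
  assumes "odd k"
  shows "(\<forall>n::nat. motzkin_sum f k n =
            (\<Sum>i = 0..n div 2.
               1 / of_nat ((k + 1) div 2 * n - i + 1)
               * of_nat (((k + 1) div 2 * n - i + 1) choose (n - 2 * i))
               * fps_nth (weight_fps f ^ ((k + 1) div 2 * n - i + 1)) i))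
       \<and> (let M = Abs_fps (motzkin_sum f k) in
            M = fps_compose (weight_fps f) (fps_X ^ 2 * M ^ k)
                * (1 + fps_X * M ^ ((k + 1) div 2)))"
proof
  let ?F = "weight_fps f" and ?h = "(k + 1) div 2"
  have "k > 0" using assms by (rule odd_pos)
  have "fps_nth ?F = (\<lambda>l. if l = 0 then 1 else f l)"
    by (auto simp: weight_fps_def)
  with block_recursion_descent_series[OF assms, of f]
  have rec: "block_recursion (fps_nth ?F) ?h k (descent_series f k)"
    by simp
  have S0: "descent_series f k 0 = 1"
    by (simp add: descent_series_def)
  have F0: "?F $ 0 = 1"
    by (simp add: weight_fps_def)
  have "block_recursion (fps_nth ?F) ?h k (lagrange_series ?F ?h k)"
    using \<open>k > 0\<close> by (intro block_recursion_lagrange_series F0) auto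
  then have eq: "descent_series f k 1 = lagrange_series ?F ?h k 1"
    by (rule block_recursion_unique[OF rec]) (simp add: S0 lagrange_series_0)
  show "\<forall>n. motzkin_sum f k n =
      (\<Sum>i = 0..n div 2. 1 / of_nat (?h * n - i + 1)
         * of_nat ((?h * n - i + 1) choose (n - 2 * i)) * (?F ^ (?h * n - i + 1)) $ i)"
  proof
    fix n
    have "motzkin_sum f k n = (\<Sum>i\<le>n div 2. lagrange_term ?F ?h k 1 i (n - 2 * i))"
      unfolding motzkin_sum_eq_descent_series eq by (simp add: lagrange_series_nth[OF F0])
    also have "\<dots> = (\<Sum>i = 0..n div 2. 1 / of_nat (?h * n - i + 1)
         * of_nat ((?h * n - i + 1) choose (n - 2 * i)) * (?F ^ (?h * n - i + 1)) $ i)"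
    proof (intro sum.cong)
      fix i assume "i \<in> {0..n div 2}"
      then have "2 * i \<le> n" by simp
      then obtain b where b: "n = b + 2 * i" by (metis le_add_diff_inverse2)
      obtain j where k: "k = 2 * j + 1" using assms by (elim oddE)
      \<comment> \<open>\<open>2 * ?h = k + 1\<close> turns \<open>k * i - 2 * ?h * i\<close> into
        \<open>- i\<close>; since \<open>2 * i \<le> n\<close>, nothing is truncated.\<close>
      have "1 + k * i + ?h * (n - 2 * i) = ?h * n - i + 1"
        by (simp add: b k algebra_simps)
      then show "lagrange_term ?F ?h k 1 i (n - 2 * i) = 1 / of_nat (?h * n - i + 1)
         * of_nat ((?h * n - i + 1) choose (n - 2 * i)) * (?F ^ (?h * n - i + 1)) $ i"
        by (simp only: lagrange_term_def of_nat_1)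
    qed auto
    finally show "motzkin_sum f k n = (\<Sum>i = 0..n div 2. 1 / of_nat (?h * n - i + 1)
         * of_nat ((?h * n - i + 1) choose (n - 2 * i)) * (?F ^ (?h * n - i + 1)) $ i)" .
  qed
  have "Abs_fps (motzkin_sum f k) = descent_series f k 1"
    by (simp add: fps_eq_iff motzkin_sum_eq_descent_series)
  then show "let M = Abs_fps (motzkin_sum f k) in
      M = fps_compose ?F (fps_X ^ 2 * M ^ k) * (1 + fps_X * M ^ ?h)"
    unfolding Let_def using block_recursion_functional_equation[OF rec S0] by simp
qed

end
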